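(* Let $(\mathcal{P},\mathcal{L})$ and $(\mathcal{P}',\mathcal{L}')$ be linear spaces such that $\dim(\mathcal{P},\mathcal{L})\geq 3$ and $\dim(\mathcal{P}',\mathcal{L}')\geq 3$. Suppose that $\varphi:\mathcal{L}\to\mathcal{L}'$ is a bijection with the property $$a\sim b \iff a^\varphi\sim' b^\varphi\quad\text{for all } a,b\in\mathcal{L},$$ where $\sim$ and $\sim'$ denote the relation "having at least one common point" on $\mathcal{L}$ and on $\mathcal{L}'$, respectively. Then the following assertions hold true: 1. Under $\varphi$ and $\varphi^{-1}$ maximal related sets go over to maximal related sets. 2. If $\varphi$ maps one (i.e. at least one) star of lines of $(\mathcal{P},\mathcal{L})$ onto a star of lines of $(\mathcal{P}',\mathcal{L}')$, then $$\kappa:\mathcal{P}\to\mathcal{P}',\quad a\cap b\mapsto a^\varphi\cap b^\varphi\qquad (a,b\in\mathcal{L},\ a\approx b)$$ is a (well-defined) collineation. 3. If $\varphi$ maps one (i.e. at least one) star of lines of $(\mathcal{P},\mathcal{L})$ onto a coplanar maximal related set of $(\mathcal{P}',\mathcal{L}')$, then $(\mathcal{P}',\mathcal{L}')$ is a $3$-dimensional generalized projective space. The mapping $$\delta:\mathcal{P}\to\mathcal{P}'^{\ast},\quad a\cap b\mapsto a^\varphi\vee b^\varphi\qquad (a,b\in\mathcal{L},\ a\approx b)$$ is a (well-defined) collineation of $(\mathcal{P},\mathcal{L})$ onto the dual linear space $(\mathcal{P}'^{\ast},\mathcal{L}'^{\ast})$ of $(\mathcal{P}',\mathcal{L}')$.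 Therefore $(\mathcal{P},\mathcal{L})$ is a $3$-dimensional generalized projective space too, and $\delta$ is a correlation of $(\mathcal{P},\mathcal{L})$ onto $(\mathcal{P}',\mathcal{L}')$.
   Context: A linear space $(\mathcal{P},\mathcal{L})$ consists of a set $\mathcal{P}$ of points and a set $\mathcal{L}$ of subsets of $\mathcal{P}$, called lines, such that any two distinct points lie on exactly one line and every line contains at least two points. A subspace is a subset $\mathcal{T}\subset\mathcal{P}$ which contains, with any two distinct points, the whole line joining them; it is itself regarded as a linear space with the lines contained in it. For $\mathcal{S}\subset\mathcal{P}$, the span $\langle\mathcal{S}\rangle$ is the intersection of all subspaces containing $\mathcal{S}$. The join of $\mathcal{S}_1,\mathcal{S}_2\subset\mathcal{P}$ is $\mathcal{S}_1\vee\mathcal{S}_2:=\langle\mathcal{S}_1\cup\mathcal{S}_2\rangle$. The dimension is $\dim(\mathcal{P},\mathcal{L}):=\min\{\#\mathcal{X}-1\mid \mathcal{X}\subset\mathcal{P},\ \langle\mathcal{X}\rangle=\mathcal{P}\}$ (possibly infinite), and similarly for subspaces. A plane is a two-dimensional subspace. A collineation between linear spaces is a bijection of the point sets which maps lines to lines in both directions (i.e. it induces a bijection between the sets of lines). Lines $a,b$ are related ($a\sim b$) if $a\cap b\neq\emptyset$; distinct related lines are called adjacent ($a\approx b$). A set of mutually related lines is a related set; a maximal related set is one that is maximal with respect to inclusion among related sets. The star of lines with vertex $A\in\mathcal{P}$ is the set $\mathcal{L}(A)$ of all lines through $A$. In a linear space of dimension $\geq 3$, every star of lines is a maximal related set,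 and the maximal related sets that are not stars of lines are called coplanar maximal related sets (the subspace spanned by all lines of such a set is a plane). A generalized projective plane is a $2$-dimensional linear space in which any two distinct lines have at least one common point. A generalized projective space is a linear space in which every plane is a generalized projective plane. For a $3$-dimensional generalized projective space $(\mathcal{P},\mathcal{L})$, any two distinct planes meet in a unique line. The dual linear space $(\mathcal{P}^\ast,\mathcal{L}^\ast)$ has as point set $\mathcal{P}^\ast$ the set of all planes of $(\mathcal{P},\mathcal{L})$, and as line set $\mathcal{L}^\ast$ the set of all pencils of planes $a^\ast$ ($a\in\mathcal{L}$), where $a^\ast$ is the set of all planes containing the line $a$. A correlation of $(\mathcal{P},\mathcal{L})$ onto $(\mathcal{P}',\mathcal{L}')$ is a collineation of $(\mathcal{P},\mathcal{L})$ onto the dual linear space of $(\mathcal{P}',\mathcal{L}')$. Conventions: images under maps are written as exponents ($a^\varphi$ is the image of $a$ under $\varphi$); a point $X$ and the set $\{X\}$ are not distinguished where convenient, so that for adjacent lines $a\approx b$ the symbol $a\cap b$ denotes their unique common point. *)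

theory Defs
  imports "HOL-Library.Extended_Real"
begin

definition linear_space :: "'a set \<Rightarrow> 'a set set \<Rightarrow> bool" where
  "linear_space P L \<longleftrightarrow>
     (\<forall>l\<in>L. l \<subseteq> P \<and> (\<exists>x\<in>l. \<exists>y\<in>l. x \<noteq> y)) \<and>
     (\<forall>x\<in>P. \<forall>y\<in>P. x \<noteq> y \<longrightarrow> (\<exists>!l. l \<in> L \<and> x \<in> l \<and> y \<in> l))"

definition ls_subspace :: "'a set \<Rightarrow> 'a set set \<Rightarrow> 'a set \<Rightarrow> bool" where
  "ls_subspace P L T \<longleftrightarrow>
     T \<subseteq> P \<and> (\<forall>x\<in>T. \<forall>y\<in>T. x \<noteq> y \<longrightarrow> (\<forall>l\<in>L. x \<in> l \<and> y \<in> l \<longrightarrow> l \<subseteq> T))"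

definition lines_in :: "'a set set \<Rightarrow> 'a set \<Rightarrow> 'a set set" where
  "lines_in L T = {l\<in>L. l \<subseteq> T}"

definition ls_span :: "'a set \<Rightarrow> 'a set set \<Rightarrow> 'a set \<Rightarrow> 'a set" where
  "ls_span P L S = \<Inter>{T. ls_subspace P L T \<and> S \<subseteq> T}"

definition ls_join :: "'a set \<Rightarrow> 'a set set \<Rightarrow> 'a set \<Rightarrow> 'a set \<Rightarrow> 'a set" where
  "ls_join P L S1 S2 = ls_span P L (S1 \<union> S2)"

definition ext_card :: "'a set \<Rightarrow> ereal" where
  "ext_card X = (if finite X then ereal (real (card X)) else \<infinity>)"

(* The infimum is a minimum: X = P spans, and the values are -1, 0, 1, ... or infinity.
   All infinite cardinalities are identified with infinity.  With ereal rather than a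
   type of truncated subtraction, the empty space has dimension -1. *)
definition ls_dim :: "'a set \<Rightarrow> 'a set set \<Rightarrow> ereal" where
  "ls_dim P L = (INF X\<in>{X. X \<subseteq> P \<and> ls_span P L X = P}. ext_card X - 1)"

definition plane :: "'a set \<Rightarrow> 'a set set \<Rightarrow> 'a set \<Rightarrow> bool" where
  "plane P L E \<longleftrightarrow> ls_subspace P L E \<and> ls_dim E (lines_in L E) = 2"

definition collineation ::
    "'a set \<Rightarrow> 'a set set \<Rightarrow> 'b set \<Rightarrow> 'b set set \<Rightarrow> ('a \<Rightarrow> 'b) \<Rightarrow> bool" where
  "collineation P L P' L' \<kappa> \<longleftrightarrow>
     linear_space P L \<and> linear_space P' L' \<and>
     bij_betw \<kappa> P P' \<and> bij_betw ((`) \<kappa>) L L'"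

definition related :: "'a set \<Rightarrow> 'a set \<Rightarrow> bool" where
  "related a b \<longleftrightarrow> a \<inter> b \<noteq> {}"

definition adjacent :: "'a set \<Rightarrow> 'a set \<Rightarrow> bool" where
  "adjacent a b \<longleftrightarrow> a \<noteq> b \<and> related a b"

definition related_set :: "'a set set \<Rightarrow> 'a set set \<Rightarrow> bool" where
  "related_set L R \<longleftrightarrow> R \<subseteq> L \<and> (\<forall>a\<in>R. \<forall>b\<in>R. related a b)"

definition maximal_related_set :: "'a set set \<Rightarrow> 'a set set \<Rightarrow> bool" where
  "maximal_related_set L R \<longleftrightarrow>
     related_set L R \<and> (\<forall>S. related_set L S \<and> R \<subseteq> S \<longrightarrow> S = R)"

definition star :: "'a set set \<Rightarrow> 'a \<Rightarrow> 'a set set" where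
  "star L A = {l\<in>L. A \<in> l}"

definition coplanar_maximal_related_set ::
    "'a set \<Rightarrow> 'a set set \<Rightarrow> 'a set set \<Rightarrow> bool" where
  "coplanar_maximal_related_set P L R \<longleftrightarrow>
     maximal_related_set L R \<and> \<not> (\<exists>A\<in>P. R = star L A)"

definition generalized_projective_plane :: "'a set \<Rightarrow> 'a set set \<Rightarrow> bool" where
  "generalized_projective_plane P L \<longleftrightarrow>
     linear_space P L \<and> ls_dim P L = 2 \<and>
     (\<forall>a\<in>L. \<forall>b\<in>L. a \<noteq> b \<longrightarrow> a \<inter> b \<noteq> {})"

definition generalized_projective_space :: "'a set \<Rightarrow> 'a set set \<Rightarrow> bool" where
  "generalized_projective_space P L \<longleftrightarrow>
     linear_space P L \<and>
     (\<forall>E. plane P L E \<longrightarrow> generalized_projective_plane E (lines_in L E))"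

definition pencil :: "'a set \<Rightarrow> 'a set set \<Rightarrow> 'a set \<Rightarrow> 'a set set" where
  "pencil P L a = {E. plane P L E \<and> a \<subseteq> E}"

definition dual_points :: "'a set \<Rightarrow> 'a set set \<Rightarrow> 'a set set" where
  "dual_points P L = {E. plane P L E}"

definition dual_lines :: "'a set \<Rightarrow> 'a set set \<Rightarrow> 'a set set set" where
  "dual_lines P L = pencil P L ` L"

definition correlation ::
    "'a set \<Rightarrow> 'a set set \<Rightarrow> 'b set \<Rightarrow> 'b set set \<Rightarrow> ('a \<Rightarrow> 'b set) \<Rightarrow> bool" where
  "correlation P L P' L' \<delta> \<longleftrightarrow>
     generalized_projective_space P L \<and> ls_dim P L = 3 \<and>
     generalized_projective_space P' L' \<and> ls_dim P' L' = 3 \<and>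
     collineation P L (dual_points P' L') (dual_lines P' L') \<delta>"

(* The common point of two adjacent lines; unspecified if a and b do not meet in exactly
   one point. *)
definition meet :: "'a set \<Rightarrow> 'a set \<Rightarrow> 'a" where
  "meet a b = the_elem (a \<inter> b)"

(* The assignment "common point of a and b \<mapsto> f a b" (a, b adjacent lines) as a
   function on points.  It is well defined on P if every point of P is the common
   point of two adjacent lines and f a b depends on that point only. *)
definition well_defined_on_meets ::
    "'a set \<Rightarrow> 'a set set \<Rightarrow> ('a set \<Rightarrow> 'a set \<Rightarrow> 'c) \<Rightarrow> bool" where
  "well_defined_on_meets P L f \<longleftrightarrow>
     (\<forall>X\<in>P. \<exists>!Y. \<exists>a\<in>L. \<exists>b\<in>L. adjacent a b \<and> a \<inter> b = {X} \<and> Y = f a b)"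

definition map_of_meets ::
    "'a set set \<Rightarrow> ('a set \<Rightarrow> 'a set \<Rightarrow> 'c) \<Rightarrow> 'a \<Rightarrow> 'c" where
  "map_of_meets L f X = (THE Y. \<exists>a\<in>L. \<exists>b\<in>L. adjacent a b \<and> a \<inter> b = {X} \<and> Y = f a b)"

end

theory Submission
  imports Defs
begin

text \<open>
  If \<open>\<phi>\<close> maps the star of \<open>A\<close> onto the star of \<open>A'\<close> but the star of \<open>B\<close> into a plane, then
  a line through \<open>A'\<close> outside this plane meets only one line of the image of the star of \<open>B\<close>,
  whereas every line through \<open>A\<close> meets many lines through \<open>B\<close>. So either all stars go to stars,
  and incidence is preserved, or no star goes to a star, in either direction. In the latter case
  let \<open>E A\<close> be the plane carrying the image of the star of \<open>A\<close>, and \<open>F X\<close> the plane carrying the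
  preimage of the star of \<open>X\<close>. Every line meets \<open>E A\<close>, and \<open>X \<in> E A\<close> is equivalent to
  \<open>A \<in> F X\<close>. This symmetry forces every line of \<open>E A\<close> to be the image of a line through \<open>A\<close>,
  so that any two lines of \<open>E A\<close> meet; moreover every plane is of the form \<open>E A\<close>.
\<close>

section \<open>Spans and planes\<close>

lemma span_superset: "S \<subseteq> ls_span P L S"
  unfolding ls_span_def by blast

lemma span_least: "ls_subspace P L T \<Longrightarrow> S \<subseteq> T \<Longrightarrow> ls_span P L S \<subseteq> T"
  unfolding ls_span_def by blast

lemma span_mono: "S \<subseteq> T \<Longrightarrow> ls_span P L S \<subseteq> ls_span P L T"
  unfolding ls_span_def by blast

lemma subspace_line:
  assumes "ls_subspace P L T" "l \<in> L" "x \<in> l" "y \<in> l" "x \<noteq> y" "x \<in> T" "y \<in> T"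
  shows "l \<subseteq> T"
  using assms unfolding ls_subspace_def by blast

text \<open>The dimension of a plane is measured inside it, with respect to its own lines. This
  equivalence is what lets relative subspaces be replaced by subspaces of the ambient space.\<close>

lemma subspace_lines_in:
  assumes E: "ls_subspace P L E"
  shows "ls_subspace E (lines_in L E) T \<longleftrightarrow> ls_subspace P L T \<and> T \<subseteq> E"
proof
  assume T: "ls_subspace E (lines_in L E) T"
  then have TE: "T \<subseteq> E" unfolding ls_subspace_def by simp
  have "l \<subseteq> T" if "x \<in> T" "y \<in> T" "x \<noteq> y" "l \<in> L" "x \<in> l" "y \<in> l" for x y l
  proof -
    have "x \<in> E" "y \<in> E" using TE that by auto
    then have "l \<subseteq> E" by (rule subspace_line[OF E that(4-6,3)])
    then have "l \<in> lines_in L E" using that unfolding lines_in_def by simp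
    then show ?thesis using subspace_line[OF T _ that(5,6,3,1,2)] by simp
  qed
  moreover have "E \<subseteq> P" using E unfolding ls_subspace_def by simp
  ultimately show "ls_subspace P L T \<and> T \<subseteq> E" using TE unfolding ls_subspace_def by simp
next
  assume T: "ls_subspace P L T \<and> T \<subseteq> E"
  have "l \<subseteq> T" if "x \<in> T" "y \<in> T" "x \<noteq> y" "l \<in> L" "x \<in> l" "y \<in> l" for x y l
    using subspace_line[OF conjunct1[OF T] that(4-6,3,1,2)] .
  then show "ls_subspace E (lines_in L E) T"
    using T unfolding ls_subspace_def lines_in_def by simp
qed

lemma subspace_inter:
  assumes "ls_subspace P L S" "ls_subspace P L T"
  shows "ls_subspace P L (S \<inter> T)"
  unfolding ls_subspace_def
proof (intro conjI ballI impI Int_greatest)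
  show "S \<inter> T \<subseteq> P" using assms(1) unfolding ls_subspace_def by blast
next
  fix x y l
  assume "x \<in> S \<inter> T" "y \<in> S \<inter> T" "x \<noteq> y" "l \<in> L" "x \<in> l \<and> y \<in> l"
  then show "l \<subseteq> S" "l \<subseteq> T"
    using subspace_line[OF assms(1), of l x y] subspace_line[OF assms(2), of l x y] by simp_all
qed

text \<open>Cutting an ambient subspace over \<open>X\<close> down to \<open>E\<close> gives a
  relative one, and every relative one is ambient, so both families have the same
  intersection.\<close>

lemma span_subspace:
  assumes E: "ls_subspace P L E" and X: "X \<subseteq> E"
  shows "ls_span E (lines_in L E) X = ls_span P L X"
proof
  show "ls_span P L X \<subseteq> ls_span E (lines_in L E) X"
    unfolding ls_span_def subspace_lines_in[OF E] by (rule Inter_anti_mono) auto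
  show "ls_span E (lines_in L E) X \<subseteq> ls_span P L X"
  proof -
    have "ls_span E (lines_in L E) X \<subseteq> T" if "ls_subspace P L T" "X \<subseteq> T" for T
      using span_least[of E "lines_in L E" "T \<inter> E" X] that X
      by (simp add: subspace_lines_in[OF E] subspace_inter E)
    then show ?thesis unfolding ls_span_def[of P L] by (intro Inter_greatest) simp
  qed
qed

lemma dim_le:
  assumes "X \<subseteq> P" "ls_span P L X = P" "finite X" "card X \<le> Suc n"
  shows "ls_dim P L \<le> ereal (real n)"
proof -
  have "ls_dim P L \<le> ext_card X - 1"
    unfolding ls_dim_def by (rule INF_lower) (use assms in auto)
  also have "\<dots> \<le> ereal (real n)"
    using assms(3,4) unfolding ext_card_def by (simp add: one_ereal_def)
  finally show ?thesis .
qed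

text \<open>Infinite spanning sets contribute infinity to the infimum, so only finite ones could
  bring it below \<open>n\<close>. The bound is \<open>n < card X\<close> because dimension is
  cardinality minus one.\<close>

lemma dim_ge:
  assumes "\<And>X. X \<subseteq> P \<Longrightarrow> ls_span P L X = P \<Longrightarrow> finite X \<Longrightarrow> n < card X"
  shows "ereal (real n) \<le> ls_dim P L"
  unfolding ls_dim_def
proof (rule INF_greatest)
  fix X assume "X \<in> {X. X \<subseteq> P \<and> ls_span P L X = P}"
  then show "ereal (real n) \<le> ext_card X - 1"
    using assms[of X] unfolding ext_card_def by (auto simp: one_ereal_def)
qed

text \<open>A strict upper bound of an infimum is undercut by some member. As cardinalities are
  integers, \<open>card X - 1 < n + 1\<close> sharpens to \<open>card X \<le> n + 1\<close>.\<close>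

lemma dim_lt_obtain:
  assumes "ls_dim P L < ereal (real (Suc n))"
  obtains X where "X \<subseteq> P" "ls_span P L X = P" "finite X" "card X \<le> Suc n"
proof -
  obtain X where X: "X \<subseteq> P" "ls_span P L X = P" "ext_card X - 1 < ereal (real (Suc n))"
    using assms unfolding ls_dim_def by (auto simp: INF_less_iff)
  have "finite X \<and> card X \<le> Suc n"
    using X(3) unfolding ext_card_def by (auto simp: one_ereal_def split: if_splits)
  then show thesis using that X by blast
qed

text \<open>For points of a linear space this describes a triangle: \<open>z\<close> differs from
  \<open>x\<close> and \<open>y\<close> automatically, since otherwise the line through
  \<open>x\<close> and \<open>y\<close> would contain all three.\<close>

definition noncollinear :: "'a set set \<Rightarrow> 'a \<Rightarrow> 'a \<Rightarrow> 'a \<Rightarrow> bool" where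
  "noncollinear L x y z \<longleftrightarrow> x \<noteq> y \<and> \<not> (\<exists>l\<in>L. x \<in> l \<and> y \<in> l \<and> z \<in> l)"

section \<open>Linear spaces: lines, subspaces and planes\<close>

locale lin_space =
  fixes P :: "'a set" and L :: "'a set set"
  assumes lin: "linear_space P L"
begin

lemma line_subset: "l \<in> L \<Longrightarrow> l \<subseteq> P"
  and line_two: "l \<in> L \<Longrightarrow> \<exists>x\<in>l. \<exists>y\<in>l. x \<noteq> y"
  and line_ex1: "x \<in> P \<Longrightarrow> y \<in> P \<Longrightarrow> x \<noteq> y \<Longrightarrow> \<exists>!l. l \<in> L \<and> x \<in> l \<and> y \<in> l"
  using lin unfolding linear_space_def by simp_all

lemma line_ne: "l \<in> L \<Longrightarrow> l \<noteq> {}"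
  using line_two[of l] by auto

lemma line_other:
  assumes "l \<in> L"
  shows "\<exists>y\<in>l. y \<noteq> x"
proof -
  obtain u v where "u \<in> l" "v \<in> l" "u \<noteq> v" using line_two[OF assms] by blast
  then show ?thesis by (cases "u = x") auto
qed

lemma line_ex: "x \<in> P \<Longrightarrow> y \<in> P \<Longrightarrow> x \<noteq> y \<Longrightarrow> \<exists>l\<in>L. x \<in> l \<and> y \<in> l"
  using line_ex1[of x y] by auto

lemma line_unique:
  assumes "l \<in> L" "m \<in> L" "x \<in> l" "y \<in> l" "x \<in> m" "y \<in> m" "x \<noteq> y"
  shows "l = m"
proof -
  have "x \<in> P" "y \<in> P" using assms line_subset by blast+
  then show ?thesis using line_ex1[of x y] assms by blast
qed

lemma adjacent_meet:
  assumes "a \<in> L" "b \<in> L" "a \<noteq> b" "X \<in> a" "X \<in> b"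
  shows "a \<inter> b = {X}"
proof -
  have "Y = X" if "Y \<in> a" "Y \<in> b" for Y
    using line_unique[OF assms(1,2) that(1) assms(4) that(2) assms(5)] assms(3) by blast
  then show ?thesis using assms(4,5) by blast
qed

lemma subspace_P: "ls_subspace P L P"
  unfolding ls_subspace_def by (simp add: line_subset)

lemma subspace_span:
  assumes "S \<subseteq> P"
  shows "ls_subspace P L (ls_span P L S)"
  unfolding ls_subspace_def
proof (intro conjI ballI impI)
  show "ls_span P L S \<subseteq> P" using span_least[OF subspace_P assms] .
next
  fix x y l
  assume xy: "x \<in> ls_span P L S" "y \<in> ls_span P L S" "x \<noteq> y"
    and l: "l \<in> L" "x \<in> l \<and> y \<in> l"
  have "l \<subseteq> T" if T: "ls_subspace P L T" "S \<subseteq> T" for T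
    using subspace_line[OF T(1), of l x y] span_least[OF T] xy l by (meson subsetD)
  then show "l \<subseteq> ls_span P L S" unfolding ls_span_def by blast
qed

lemma span_subset: "S \<subseteq> P \<Longrightarrow> ls_span P L S \<subseteq> P"
  using span_least[OF subspace_P] .

lemma line_in_span:
  assumes "l \<in> L" "x \<in> l" "y \<in> l" "x \<noteq> y" "x \<in> S" "y \<in> S" "S \<subseteq> P"
  shows "l \<subseteq> ls_span P L S"
  by (rule subspace_line[OF subspace_span[OF assms(7)] assms(1-4)];
      rule subsetD[OF span_superset]; fact)

lemma subspace_of_line:
  assumes l: "l \<in> L"
  shows "ls_subspace P L l"
  unfolding ls_subspace_def
proof (intro conjI ballI impI)
  show "l \<subseteq> P" by (rule line_subset[OF l])
next
  fix x y m
  assume "x \<in> l" "y \<in> l" "x \<noteq> y" "m \<in> L" "x \<in> m \<and> y \<in> m"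
  then have "m = l" using line_unique[of m l x y] l by simp
  then show "m \<subseteq> l" by simp
qed

lemma linear_subspace:
  assumes "ls_subspace P L E"
  shows "linear_space E (lines_in L E)"
proof -
  have "\<exists>!l. l \<in> lines_in L E \<and> x \<in> l \<and> y \<in> l" if xy: "x \<in> E" "y \<in> E" "x \<noteq> y" for x y
  proof -
    have "x \<in> P" "y \<in> P" using assms xy unfolding ls_subspace_def by auto
    then obtain l where l: "l \<in> L" "x \<in> l" "y \<in> l" using line_ex[of x y] xy by blast
    then have "l \<subseteq> E" using subspace_line[OF assms l xy(3,1,2)] by simp
    then have "l \<in> lines_in L E" using l unfolding lines_in_def by simp
    moreover have "m = l" if "m \<in> lines_in L E" "x \<in> m" "y \<in> m" for m
      using line_unique[OF _ l(1) that(2,3) l(2,3) xy(3)] that(1) unfolding lines_in_def by simp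
    ultimately show ?thesis using l(2,3) by metis
  qed
  then show ?thesis unfolding linear_space_def lines_in_def using line_two by auto
qed

text \<open>Serves to show that at most two points never span a plane. The distinct points
  \<open>x\<close> and \<open>y\<close> allow an empty set or a singleton to be enlarged to a
  pair.\<close>

lemma pair_in_line:
  assumes "x \<in> P" "y \<in> P" "x \<noteq> y" "X \<subseteq> P" "finite X" "card X \<le> 2"
  shows "\<exists>l\<in>L. X \<subseteq> l"
proof -
  have "\<exists>p\<in>P. \<exists>q\<in>P. p \<noteq> q \<and> X \<subseteq> {p, q}"
  proof -
    consider "card X = 0" | "card X = 1" | "card X = 2" using assms(6) by linarith
    then show ?thesis
    proof cases
      case 1
      then show ?thesis using assms by auto
    next
      case 2
      then obtain p where "X = {p}" by (auto simp: card_1_singleton_iff)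
      then show ?thesis using assms by blast
    next
      case 3
      then obtain p q where "X = {p, q}" "p \<noteq> q" by (auto simp: card_2_iff)
      then show ?thesis using assms by blast
    qed
  qed
  then obtain p q where pq: "p \<in> P" "q \<in> P" "p \<noteq> q" "X \<subseteq> {p, q}" by blast
  then obtain l where "l \<in> L" "p \<in> l" "q \<in> l" using line_ex by blast
  then show ?thesis using pq by blast
qed

text \<open>The three points bound the dimension by 2. A spanning set with at most two points lies
  on a line, which would then contain \<open>x\<close>, \<open>y\<close> and
  \<open>z\<close>.\<close>

lemma plane_span:
  assumes "x \<in> P" "y \<in> P" "z \<in> P" "noncollinear L x y z"
  shows "plane P L (ls_span P L {x, y, z})"
proof -
  let ?E = "ls_span P L {x, y, z}"
  have E: "ls_subspace P L ?E" using subspace_span[of "{x, y, z}"] assms by simp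
  have xyz: "{x, y, z} \<subseteq> ?E" by (rule span_superset)
  have EP: "?E \<subseteq> P" using E unfolding ls_subspace_def by blast
  have card: "card {x, y, z} \<le> Suc 2" by (simp add: card_insert_if)
  have le: "ls_dim ?E (lines_in L ?E) \<le> ereal (real 2)"
    by (rule dim_le[OF xyz span_subspace[OF E xyz] _ card]) simp
  have ge: "ereal (real 2) \<le> ls_dim ?E (lines_in L ?E)"
  proof (rule dim_ge, rule ccontr)
    fix X assume X: "X \<subseteq> ?E" "ls_span ?E (lines_in L ?E) X = ?E" "finite X" "\<not> 2 < card X"
    have "X \<subseteq> P" "card X \<le> 2" "x \<noteq> y"
      using X EP assms(4) unfolding noncollinear_def by auto
    then obtain l where l: "l \<in> L" "X \<subseteq> l"
      using pair_in_line[of x y X] assms X(3) by blast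
    then have "?E \<subseteq> l"
      using span_subspace[OF E X(1)] span_least[OF subspace_of_line, of l X] X(2) by simp
    then show False using xyz l assms(4) unfolding noncollinear_def by blast
  qed
  show ?thesis using E le ge unfolding plane_def by simp
qed

text \<open>Dimension 2 provides a spanning set of exactly three points. Were these on a line, two
  of them would already span, which \<open>big\<close> excludes.\<close>

lemma plane_obtain:
  assumes "plane P L E"
  obtains x y z where "x \<in> P" "y \<in> P" "z \<in> P" "noncollinear L x y z" "E = ls_span P L {x, y, z}"
proof -
  have E: "ls_subspace P L E" and dim: "ls_dim E (lines_in L E) = 2"
    using assms unfolding plane_def by auto
  then have EP: "E \<subseteq> P" unfolding ls_subspace_def by blast
  \<comment> \<open>A spanning set of at most two points would lower the dimension to 1.\<close>
  have big: "2 < card X" if "X \<subseteq> E" "ls_span P L X = E" "finite X" for X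
  proof (rule ccontr)
    assume "\<not> 2 < card X"
    then have "ls_dim E (lines_in L E) \<le> ereal (real 1)"
      using dim_le[of X E "lines_in L E" 1] span_subspace[OF E that(1)] that by simp
    then show False using dim by simp
  qed
  have "ls_dim E (lines_in L E) < ereal (real (Suc 2))" using dim by simp
  then obtain X where X: "X \<subseteq> E" "ls_span E (lines_in L E) X = E" "finite X" "card X \<le> Suc 2"
    by (rule dim_lt_obtain)
  then have sp: "ls_span P L X = E" using span_subspace[OF E] by simp
  then have "card X = 3" using big[OF X(1) sp X(3)] X(4) by simp
  then obtain x y z where xyz: "X = {x, y, z}" "x \<noteq> y" "y \<noteq> z" "x \<noteq> z"
    unfolding card_3_iff by (elim exE conjE)
  have "noncollinear L x y z"
  proof (rule ccontr)
    assume "\<not> noncollinear L x y z"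
    then obtain l where l: "l \<in> L" "x \<in> l" "y \<in> l" "z \<in> l"
      using xyz unfolding noncollinear_def by blast
    have S: "ls_subspace P L (ls_span P L {x, y})"
      using subspace_span[of "{x, y}"] X xyz EP by blast
    have "l \<subseteq> ls_span P L {x, y}"
      using line_in_span[OF l(1-3) xyz(2), of "{x, y}"] X xyz EP by blast
    then have "X \<subseteq> ls_span P L {x, y}" using l xyz(1) by blast
    then have "ls_span P L X \<subseteq> ls_span P L {x, y}" by (rule span_least[OF S])
    then have "ls_span P L {x, y} = E" using sp span_mono[of "{x,y}" X P L] xyz(1) by blast
    then have "2 < card {x, y}" using big[of "{x, y}"] X(1) xyz(1) by simp
    then show False using xyz by simp
  qed
  moreover have "x \<in> P" "y \<in> P" "z \<in> P" using X(1) EP xyz(1) by auto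
  ultimately show thesis using that[of x y z] sp xyz(1) by simp
qed

text \<open>As \<open>R\<close> is no star, some \<open>c\<close> in \<open>R\<close> avoids the
  common point \<open>A\<close> of \<open>a\<close> and \<open>b\<close>, so \<open>a\<close>,
  \<open>b\<close>, \<open>c\<close> are the sides of a triangle. Any line of \<open>R\<close> meets
  the sides in at least two distinct points and hence lies in the plane of the triangle. Thus any
  two distinct lines of \<open>R\<close> span the same plane as \<open>R\<close>.\<close>

lemma coplanar_triangle:
  assumes R: "coplanar_maximal_related_set P L R" and ab: "a \<in> R" "b \<in> R" "a \<noteq> b"
  obtains x y z where "x \<in> P" "y \<in> P" "z \<in> P" "noncollinear L x y z"
    "ls_span P L (\<Union>R) = ls_span P L {x, y, z}" "ls_span P L (\<Union>R) = ls_span P L (a \<union> b)"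
proof -
  have max: "maximal_related_set L R" and nostar: "\<And>A. A \<in> P \<Longrightarrow> R \<noteq> star L A"
    using R unfolding coplanar_maximal_related_set_def by auto
  have RL: "R \<subseteq> L" and rel: "\<And>a b. a \<in> R \<Longrightarrow> b \<in> R \<Longrightarrow> a \<inter> b \<noteq> {}"
    using max unfolding maximal_related_set_def related_set_def related_def by auto
  obtain A where A: "A \<in> a" "A \<in> b" using rel ab by blast
  have AP: "A \<in> P" using A ab RL line_subset by blast
  \<comment> \<open>Otherwise \<open>R\<close> is contained in the star of \<open>A\<close>, which
    is a related set, and maximality makes them equal.\<close>
  have "\<exists>c\<in>R. A \<notin> c"
  proof (rule ccontr)
    assume "\<not> ?thesis"
    then have "R \<subseteq> star L A" using RL unfolding star_def by blast
    moreover have "related_set L (star L A)"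
      unfolding related_set_def star_def related_def by blast
    ultimately show False using max nostar[OF AP] unfolding maximal_related_set_def by blast
  qed
  then obtain c where c: "c \<in> R" "A \<notin> c" by blast
  obtain B where B: "B \<in> a" "B \<in> c" using rel ab c by blast
  obtain C where C: "C \<in> b" "C \<in> c" using rel ab c by blast
  have L: "a \<in> L" "b \<in> L" "c \<in> L" using ab c RL by auto
  have P: "B \<in> P" "C \<in> P" using B C L line_subset by blast+
  have ne: "A \<noteq> B" "A \<noteq> C" using c B C by auto
  have BC: "B \<noteq> C"
    using line_unique[of a b A B] L A B C ne ab by blast
  have nc: "noncollinear L A B C"
    unfolding noncollinear_def
    using ne line_unique[of _ a A B] line_unique[of _ b A C] L A B C ab by blast
  let ?T = "ls_span P L {A, B, C}"
  have T: "ls_subspace P L ?T" using subspace_span[of "{A, B, C}"] AP P by simp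
  have ABC: "A \<in> ?T" "B \<in> ?T" "C \<in> ?T" using span_superset[of "{A,B,C}"] by auto
  have abc: "a \<subseteq> ?T" "b \<subseteq> ?T" "c \<subseteq> ?T"
    by (rule subspace_line[OF T L(1) A(1) B(1) ne(1) ABC(1,2)]
        subspace_line[OF T L(2) A(2) C(1) ne(2) ABC(1,3)]
        subspace_line[OF T L(3) B(2) C(2) BC ABC(2,3)])+
  have UR: "\<Union>R \<subseteq> ?T"
  proof
    fix p assume "p \<in> \<Union>R"
    then obtain d where d: "d \<in> R" "p \<in> d" by blast
    obtain D1 where D1: "D1 \<in> d" "D1 \<in> a" using rel ab d by blast
    obtain D2 where D2: "D2 \<in> d" "D2 \<in> b" using rel ab d by blast
    obtain D3 where D3: "D3 \<in> d" "D3 \<in> c" using rel c d by blast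
    have "a \<inter> b = {A}" by (rule adjacent_meet[OF L(1,2) ab(3) A])
    then have "D1 = D2 \<Longrightarrow> D1 = A" using D1(2) D2(2) by blast
    \<comment> \<open>If all three points coincided, they would equal \<open>A\<close>, which is not
      on \<open>c\<close>.\<close>
    then have "D1 \<noteq> D2 \<or> D1 \<noteq> D3" using c(2) D3(2) by metis
    moreover have D: "D1 \<in> ?T" "D2 \<in> ?T" "D3 \<in> ?T"
      using abc D1(2) D2(2) D3(2) by (simp_all add: subsetD)
    have "d \<in> L" using RL d(1) by (rule subsetD)
    ultimately have "d \<subseteq> ?T"
      using subspace_line[OF T _ D1(1) D2(1) _ D(1,2)] subspace_line[OF T _ D1(1) D3(1) _ D(1,3)]
      by metis
    then show "p \<in> ?T" using d by blast
  qed
  have sub: "{A, B, C} \<subseteq> a \<union> b" "a \<union> b \<subseteq> \<Union>R" using A B C ab by auto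
  have 1: "ls_span P L (\<Union>R) \<subseteq> ?T" using span_least[OF T UR] .
  have 2: "?T \<subseteq> ls_span P L (a \<union> b)" "ls_span P L (a \<union> b) \<subseteq> ls_span P L (\<Union>R)"
    using sub by (simp_all add: span_mono)
  then show thesis using that[OF AP P nc] 1 by blast
qed

lemma coplanar_subspace:
  assumes "coplanar_maximal_related_set P L R"
  shows "ls_subspace P L (ls_span P L (\<Union>R))"
proof -
  have "\<Union>R \<subseteq> P"
    using assms line_subset
    unfolding coplanar_maximal_related_set_def maximal_related_set_def related_set_def by blast
  then show ?thesis by (rule subspace_span)
qed

end

section \<open>Dimension at least three: stars of lines and collineations\<close>

locale lin_space3 = lin_space +
  assumes dim3: "ls_dim P L \<ge> 3"
begin

text \<open>Three points spanning \<open>P\<close> would give dimension at most 2. The points may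
  coincide, so repeating one of them also covers lines and single points.\<close>

lemma span_three:
  assumes "x \<in> P" "y \<in> P" "z \<in> P"
  shows "\<exists>q\<in>P. q \<notin> ls_span P L {x, y, z}"
proof (rule ccontr)
  assume "\<not> ?thesis"
  then have "ls_span P L {x, y, z} = P" using span_subset[of "{x,y,z}"] assms by blast
  moreover have "card {x, y, z} \<le> Suc 2" by (simp add: card_insert_if)
  ultimately have "ls_dim P L \<le> ereal (real 2)" using dim_le[of "{x,y,z}" P L 2] assms by simp
  then show False using dim3 order_trans by force
qed

lemma point_off_line:
  assumes "l \<in> L"
  shows "\<exists>q\<in>P. q \<notin> l"
proof -
  obtain x y where xy: "x \<in> l" "y \<in> l" "x \<noteq> y" using line_two assms by blast
  then have P: "x \<in> P" "y \<in> P" using line_subset assms by blast+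
  have "l \<subseteq> ls_span P L {x, y, y}"
    using line_in_span[OF assms xy, of "{x, y, y}"] P by simp
  then show ?thesis using span_three P by blast
qed

lemma other_point:
  assumes "x \<in> P"
  shows "\<exists>y\<in>P. y \<noteq> x"
proof -
  obtain y where "y \<in> P" "y \<notin> ls_span P L {x, x, x}" using span_three[OF assms assms assms] ..
  moreover have "x \<in> ls_span P L {x, x, x}" by (rule subsetD[OF span_superset]) simp
  ultimately show ?thesis by metis
qed

lemma two_lines_through:
  assumes "x \<in> P"
  shows "\<exists>a\<in>L. \<exists>b\<in>L. a \<noteq> b \<and> x \<in> a \<and> x \<in> b"
proof -
  obtain y where "y \<in> P" "y \<noteq> x" using other_point assms by blast
  then obtain a where a: "a \<in> L" "x \<in> a" using line_ex assms by blast
  then obtain q where "q \<in> P" "q \<notin> a" using point_off_line by blast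
  then obtain b where "b \<in> L" "x \<in> b" "q \<in> b" using line_ex assms a by metis
  then show ?thesis using a \<open>q \<notin> a\<close> by blast
qed

lemma star_inj:
  assumes "A \<in> P" "B \<in> P" "star L A = star L B"
  shows "A = B"
proof (rule ccontr)
  assume ne: "A \<noteq> B"
  obtain a b where ab: "a \<in> L" "b \<in> L" "a \<noteq> b" "A \<in> a" "A \<in> b"
    using two_lines_through assms by blast
  then have "a \<in> star L B" "b \<in> star L B" using assms(3) unfolding star_def by blast+
  then show False using line_unique[of a b A B] ab ne unfolding star_def by blast
qed

text \<open>A line \<open>l\<close> not through \<open>A\<close> lies with \<open>A\<close> in the
  span of three points. Some point \<open>q\<close> is outside this span, and the line joining
  \<open>A\<close> and \<open>q\<close> meets the span in \<open>A\<close> alone, so it cannot meet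
  \<open>l\<close>.\<close>

lemma star_maximal:
  assumes A: "A \<in> P"
  shows "maximal_related_set L (star L A)"
proof -
  have "S = star L A" if S: "related_set L S" "star L A \<subseteq> S" for S
  proof (rule ccontr)
    assume "S \<noteq> star L A"
    then obtain l where l: "l \<in> S" "l \<in> L" "A \<notin> l"
      using S unfolding related_set_def star_def by blast
    obtain x y where xy: "x \<in> l" "y \<in> l" "x \<noteq> y" using line_two l by blast
    then have P: "x \<in> P" "y \<in> P" using line_subset l by blast+
    let ?T = "ls_span P L {A, x, y}"
    have T: "ls_subspace P L ?T" using subspace_span[of "{A, x, y}"] P A by simp
    have AT: "A \<in> ?T" and lT: "l \<subseteq> ?T"
      using line_in_span[OF l(2) xy, of "{A, x, y}"] span_superset[of "{A,x,y}" P L] A P by simp_all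
    obtain q where q: "q \<in> P" "q \<notin> ?T" using span_three[OF A P] by blast
    then have "A \<noteq> q" using AT by blast
    then obtain m where m: "m \<in> L" "A \<in> m" "q \<in> m" using line_ex[OF A q(1)] by blast
    then have "m \<in> S" using S unfolding star_def by blast
    then obtain u where "u \<in> m" "u \<in> l"
      using S l unfolding related_set_def related_def by blast
    then have "m \<subseteq> ?T"
      using subspace_line[OF T m(1), of A u] m(2) AT subsetD[OF lT, of u] l(3) by blast
    then show False using q m by blast
  qed
  moreover have "related_set L (star L A)"
    unfolding related_set_def star_def related_def by blast
  ultimately show ?thesis unfolding maximal_related_set_def by blast
qed

text \<open>Every point is the intersection of two distinct lines, so a value that depends only on
  the common point exists and is unique. Both the well-definedness and the evaluation of
  \<open>map_of_meets\<close> follow from this.\<close>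

lemma meets_unique:
  assumes f: "\<And>a b X. a \<in> L \<Longrightarrow> b \<in> L \<Longrightarrow> a \<noteq> b \<Longrightarrow> X \<in> a \<Longrightarrow> X \<in> b \<Longrightarrow> f a b = k X"
    and X: "X \<in> P"
  shows "(\<exists>a\<in>L. \<exists>b\<in>L. adjacent a b \<and> a \<inter> b = {X} \<and> Y = f a b) \<longleftrightarrow> Y = k X"
proof
  assume "\<exists>a\<in>L. \<exists>b\<in>L. adjacent a b \<and> a \<inter> b = {X} \<and> Y = f a b"
  then obtain a b where ab: "a \<in> L" "b \<in> L" "adjacent a b" "a \<inter> b = {X}" "Y = f a b"
    by (elim bexE conjE)
  have "X \<in> a \<inter> b" unfolding ab(4) by simp
  then show "Y = k X" using f[OF ab(1,2)] ab(3,5) unfolding adjacent_def by simp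
next
  assume Y: "Y = k X"
  obtain a b where ab: "a \<in> L" "b \<in> L" "a \<noteq> b" "X \<in> a" "X \<in> b"
    using two_lines_through[OF X] by (elim bexE conjE)
  have int: "a \<inter> b = {X}" by (rule adjacent_meet[OF ab])
  then have "adjacent a b" using ab(3) unfolding adjacent_def related_def by simp
  then show "\<exists>a\<in>L. \<exists>b\<in>L. adjacent a b \<and> a \<inter> b = {X} \<and> Y = f a b"
    using ab(1,2) int f[OF ab] Y by (intro bexI[of _ a] bexI[of _ b] conjI) simp_all
qed

lemma well_defined_meets:
  assumes "\<And>a b X. a \<in> L \<Longrightarrow> b \<in> L \<Longrightarrow> a \<noteq> b \<Longrightarrow> X \<in> a \<Longrightarrow> X \<in> b \<Longrightarrow> f a b = k X"
  shows "well_defined_on_meets P L f"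
  unfolding well_defined_on_meets_def using meets_unique[of f k, OF assms] by simp

lemma map_of_meets_eq:
  assumes "\<And>a b X. a \<in> L \<Longrightarrow> b \<in> L \<Longrightarrow> a \<noteq> b \<Longrightarrow> X \<in> a \<Longrightarrow> X \<in> b \<Longrightarrow> f a b = k X"
    and "X \<in> P"
  shows "map_of_meets L f X = k X"
  unfolding map_of_meets_def using meets_unique[of f k, OF assms] by simp

text \<open>The axioms of a linear space are transported along the injection. A target that is an
  image of \<open>P\<close> and \<open>L\<close>, such as the dual space later on, therefore needs
  no separate proof of linearity.\<close>

lemma collineation_image:
  assumes inj: "inj_on \<delta> P"
  shows "collineation P L (\<delta> ` P) ((`) \<delta> ` L) \<delta>"
proof -
  have mem: "x \<in> l" if "x \<in> P" "l \<in> L" "\<delta> x \<in> \<delta> ` l" for x l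
    using inj_on_image_mem_iff[OF inj that(1) line_subset[OF that(2)]] that(3) by simp
  have "m \<subseteq> \<delta> ` P \<and> (\<exists>x\<in>m. \<exists>y\<in>m. x \<noteq> y)" if "m \<in> (`) \<delta> ` L" for m
  proof -
    obtain l where l: "l \<in> L" "m = \<delta> ` l" using \<open>m \<in> (`) \<delta> ` L\<close> by (elim imageE)
    obtain x y where xy: "x \<in> l" "y \<in> l" "x \<noteq> y" using line_two[OF l(1)] by (elim bexE)
    have "l \<subseteq> P" by (rule line_subset[OF l(1)])
    then have "\<delta> x \<noteq> \<delta> y" using inj_on_eq_iff[OF inj, of x y] xy by (simp add: subsetD)
    then show ?thesis using \<open>l \<subseteq> P\<close> xy(1,2) unfolding l(2) by (auto simp: image_mono)
  qed
  moreover have "\<exists>!m. m \<in> (`) \<delta> ` L \<and> u \<in> m \<and> v \<in> m"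
    if uv: "u \<in> \<delta> ` P" "v \<in> \<delta> ` P" "u \<noteq> v" for u v
  proof -
    obtain x where x: "x \<in> P" "u = \<delta> x" using uv(1) by (elim imageE)
    obtain y where y: "y \<in> P" "v = \<delta> y" using uv(2) by (elim imageE)
    have "x \<noteq> y" using uv(3) x(2) y(2) by auto
    then obtain l where l: "l \<in> L" "x \<in> l" "y \<in> l" using line_ex[OF x(1) y(1)] by auto
    show ?thesis
    proof (rule ex1I[of _ "\<delta> ` l"])
      show "\<delta> ` l \<in> (`) \<delta> ` L \<and> u \<in> \<delta> ` l \<and> v \<in> \<delta> ` l" using l x(2) y(2) by simp
    next
      fix m assume m: "m \<in> (`) \<delta> ` L \<and> u \<in> m \<and> v \<in> m"
      then obtain n where n: "n \<in> L" "m = \<delta> ` n" by (elim conjE imageE)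
      have "x \<in> n" "y \<in> n" using mem[OF _ n(1)] m x y n(2) by simp_all
      then have "n = l" using line_unique[OF n(1) l(1) _ _ l(2,3)] \<open>x \<noteq> y\<close> by simp
      then show "m = \<delta> ` l" using n(2) by simp
    qed
  qed
  ultimately have "linear_space (\<delta> ` P) ((`) \<delta> ` L)" unfolding linear_space_def by simp
  moreover have "inj_on ((`) \<delta>) L"
    by (rule inj_onI) (simp add: inj_on_image_eq_iff[OF inj] line_subset)
  ultimately show ?thesis
    using inj lin unfolding collineation_def by (simp add: inj_on_imp_bij_betw)
qed

lemma incidence_collineation:
  assumes mem: "\<And>X. X \<in> P \<Longrightarrow> \<kappa> X \<in> Q"
    and surj: "\<And>X'. X' \<in> Q \<Longrightarrow> \<exists>X\<in>P. \<kappa> X = X'"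
    and M: "M = g ` L"
    and inc: "\<And>X l. X \<in> P \<Longrightarrow> l \<in> L \<Longrightarrow> \<kappa> X \<in> g l \<longleftrightarrow> X \<in> l"
    and sub: "\<And>l. l \<in> L \<Longrightarrow> g l \<subseteq> Q"
  shows "collineation P L Q M \<kappa>"
proof -
  have "inj_on \<kappa> P"
  proof (rule inj_onI)
    fix X Y assume XY: "X \<in> P" "Y \<in> P" "\<kappa> X = \<kappa> Y"
    then have "X \<in> l \<longleftrightarrow> Y \<in> l" if "l \<in> L" for l
      using inc[OF XY(1) that] inc[OF XY(2) that] by simp
    then have "star L X = star L Y" unfolding star_def by auto
    then show "X = Y" by (rule star_inj[OF XY(1,2)])
  qed
  moreover have "\<kappa> ` P = Q"
  proof
    show "\<kappa> ` P \<subseteq> Q" using mem by (rule image_subsetI)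
    show "Q \<subseteq> \<kappa> ` P" using surj by (auto simp: image_iff)
  qed
  moreover have "\<kappa> ` l = g l" if l: "l \<in> L" for l
  proof
    show "\<kappa> ` l \<subseteq> g l" using inc[OF _ l] subsetD[OF line_subset[OF l]] by auto
    show "g l \<subseteq> \<kappa> ` l"
    proof
      fix X' assume X': "X' \<in> g l"
      obtain X where "X \<in> P" "\<kappa> X = X'" using surj[OF subsetD[OF sub[OF l] X']] by (elim bexE)
      then show "X' \<in> \<kappa> ` l" using inc[of X l] l X' by auto
    qed
  qed
  then have "(`) \<kappa> ` L = M" unfolding M by (rule image_cong[OF refl])
  ultimately show ?thesis using collineation_image[of \<kappa>] by simp
qed

lemma coplanar_off:
  assumes "coplanar_maximal_related_set P L R" "a \<in> R" "b \<in> R" "a \<noteq> b"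
  shows "\<exists>q\<in>P. q \<notin> ls_span P L (\<Union>R)"
proof -
  obtain x y z where "x \<in> P" "y \<in> P" "z \<in> P" "ls_span P L (\<Union>R) = ls_span P L {x, y, z}"
    using coplanar_triangle[OF assms] .
  then show ?thesis using span_three[of x y z] by simp
qed

end

section \<open>Bijections preserving relatedness\<close>

text \<open>The inverse \<open>\<psi>\<close> is a parameter rather than a derived term, so that the
  two spaces can be exchanged and each result can be reused for \<open>\<psi>\<close>.\<close>

locale chow = S: lin_space3 P L + S': lin_space3 P' L'
  for P :: "'a set" and L and P' :: "'b set" and L' +
  fixes \<phi> :: "'a set \<Rightarrow> 'b set" and \<psi> :: "'b set \<Rightarrow> 'a set"
  assumes phi_in: "a \<in> L \<Longrightarrow> \<phi> a \<in> L'"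
    and psi_in: "a' \<in> L' \<Longrightarrow> \<psi> a' \<in> L"
    and psi_phi: "a \<in> L \<Longrightarrow> \<psi> (\<phi> a) = a"
    and phi_psi: "a' \<in> L' \<Longrightarrow> \<phi> (\<psi> a') = a'"
    and rel: "a \<in> L \<Longrightarrow> b \<in> L \<Longrightarrow> related (\<phi> a) (\<phi> b) \<longleftrightarrow> related a b"
begin

lemma swap: "chow P' L' P L \<psi> \<phi>"
proof unfold_locales
  fix a b assume "a \<in> L'" "b \<in> L'"
  then show "related (\<psi> a) (\<psi> b) \<longleftrightarrow> related a b"
    using rel[of "\<psi> a" "\<psi> b"] by (simp add: psi_in phi_psi)
qed (auto simp: phi_in psi_in phi_psi psi_phi)

lemma phi_inj:
  assumes "a \<in> L" "b \<in> L" "\<phi> a = \<phi> b"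
  shows "a = b"
  using arg_cong[OF assms(3), of \<psi>] unfolding psi_phi[OF assms(1)] psi_phi[OF assms(2)] .

lemma psi_image_phi:
  assumes "R \<subseteq> L"
  shows "\<psi> ` \<phi> ` R = R"
proof -
  have "\<psi> ` \<phi> ` R = (\<lambda>a. a) ` R"
    unfolding image_image by (rule image_cong[OF refl]) (use assms in \<open>simp add: psi_phi subset_iff\<close>)
  then show ?thesis by simp
qed

lemma related_set_image: "related_set L R \<Longrightarrow> related_set L' (\<phi> ` R)"
  unfolding related_set_def by (auto simp: phi_in rel subset_iff)

text \<open>A related set containing the image is pulled back by \<open>\<psi>\<close> to a related
  set containing \<open>R\<close>, which must be \<open>R\<close> itself.\<close>

lemma maximal_image:
  assumes "maximal_related_set L R"
  shows "maximal_related_set L' (\<phi> ` R)"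
proof -
  interpret D: chow P' L' P L \<psi> \<phi> by (rule swap)
  have R: "related_set L R" "R \<subseteq> L"
    using assms unfolding maximal_related_set_def related_set_def by auto
  have "S = \<phi> ` R" if S: "related_set L' S" "\<phi> ` R \<subseteq> S" for S
  proof -
    have "\<psi> ` \<phi> ` R \<subseteq> \<psi> ` S" using S(2) by (rule image_mono)
    then have "R \<subseteq> \<psi> ` S" unfolding psi_image_phi[OF R(2)] .
    then have "\<psi> ` S = R"
      using assms D.related_set_image[OF S(1)] unfolding maximal_related_set_def by blast
    moreover have "S \<subseteq> L'" using S(1) unfolding related_set_def by blast
    ultimately show ?thesis using D.psi_image_phi[of S] by simp
  qed
  then show ?thesis using related_set_image[OF R(1)] unfolding maximal_related_set_def by blast
qed

text \<open>Replaces membership in an image of a star by plain incidence of \<open>A\<close> with a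
  line.\<close>

lemma image_star_iff:
  assumes "l' \<in> L'"
  shows "l' \<in> \<phi> ` star L A \<longleftrightarrow> A \<in> \<psi> l'"
proof -
  have "l' = \<phi> (\<psi> l')" using assms phi_psi by simp
  then show ?thesis using assms psi_phi psi_in unfolding star_def by auto
qed

text \<open>Suppose the image of the star of \<open>B\<close> spans a plane \<open>?E\<close>. With
  \<open>l\<close> the line joining \<open>A\<close> and \<open>B\<close>, the point
  \<open>A'\<close> is on \<open>\<phi> l\<close>, hence in \<open>?E\<close>. A line
  \<open>a'\<close> through \<open>A'\<close> leaving \<open>?E\<close> comes from a line
  \<open>a\<close> through \<open>A\<close>. Joining \<open>B\<close> to a second point
  \<open>C\<close> of \<open>a\<close> gives a line \<open>m\<close> whose image meets
  \<open>a'\<close> in a point of \<open>?E\<close> other than \<open>A'\<close>, so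
  \<open>a'\<close> is in \<open>?E\<close> after all.\<close>

lemma star_to_star:
  assumes A: "A \<in> P" "A' \<in> P'" "\<phi> ` star L A = star L' A'" and B: "B \<in> P"
  shows "\<exists>B'\<in>P'. \<phi> ` star L B = star L' B'"
proof (rule ccontr)
  assume no: "\<not> ?thesis"
  then have AB: "A \<noteq> B" using A by blast
  let ?R = "\<phi> ` star L B"
  let ?E = "ls_span P' L' (\<Union>?R)"
  have cop: "coplanar_maximal_related_set P' L' ?R"
    using no maximal_image[OF S.star_maximal[OF B]]
    unfolding coplanar_maximal_related_set_def by blast
  have E: "ls_subspace P' L' ?E" by (rule S'.coplanar_subspace[OF cop])
  have RE: "r \<subseteq> ?E" if "r \<in> ?R" for r using that span_superset[of "\<Union>?R"] by blast
  obtain l where l: "l \<in> L" "A \<in> l" "B \<in> l" using S.line_ex A B AB by blast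
  have lR: "\<phi> l \<in> ?R" and "\<phi> l \<in> star L' A'"
    using l A(3) unfolding star_def by blast+
  then have A'E: "A' \<in> ?E" using RE unfolding star_def by blast
  obtain b c where "b \<in> L" "c \<in> L" "b \<noteq> c" "B \<in> b" "B \<in> c"
    using S.two_lines_through B by blast
  then have "\<phi> b \<in> ?R" "\<phi> c \<in> ?R" "\<phi> b \<noteq> \<phi> c"
    using phi_inj[of b c] unfolding star_def by auto
  then have "\<exists>q\<in>P'. q \<notin> ?E" by (rule S'.coplanar_off[OF cop])
  then obtain q where q: "q \<in> P'" "q \<notin> ?E" ..
  then have "A' \<noteq> q" using A'E by blast
  then obtain a' where a': "a' \<in> L'" "A' \<in> a'" "q \<in> a'"
    using S'.line_ex[OF A(2) q(1)] by blast
  then have "a' \<in> \<phi> ` star L A" using A(3) unfolding star_def by blast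
  then obtain a where a: "a \<in> L" "A \<in> a" "a' = \<phi> a" unfolding star_def by blast
  have al: "a \<noteq> l" using RE[OF lR] a a' q by blast
  obtain C where C: "C \<in> a" "C \<noteq> A" using S.line_other a by blast
  have "C \<noteq> B" using al S.line_unique[OF a(1) l(1) a(2) _ l(2)] C(1) l(3) AB by blast
  then obtain m where m: "m \<in> L" "B \<in> m" "C \<in> m"
    using S.line_ex[of B C] B C(1) subsetD[OF S.line_subset[OF a(1)]] by blast
  have "m \<noteq> l" using al S.line_unique[OF a(1) l(1) C(1) a(2) _ l(2) C(2)] m(3) by blast
  have mR: "\<phi> m \<in> ?R" using m unfolding star_def by blast
  have "related a m" using C m unfolding related_def by blast
  then obtain u where u: "u \<in> a'" "u \<in> \<phi> m"
    using rel a m unfolding related_def by blast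
  \<comment> \<open>If \<open>\<phi> m\<close> passed through \<open>A'\<close>, then
    \<open>m\<close> would pass through \<open>A\<close> as well as \<open>B\<close> and would be
    \<open>l\<close>.\<close>
  have "u \<noteq> A'"
  proof
    assume "u = A'"
    then have "\<phi> m \<in> star L' A'" using u(2) phi_in[OF m(1)] unfolding star_def by simp
    then have "\<phi> m \<in> \<phi> ` star L A" by (simp only: A(3))
    then have "A \<in> m" using image_star_iff[OF phi_in[OF m(1)], of A] psi_phi[OF m(1)] by simp
    then show False using \<open>m \<noteq> l\<close> S.line_unique[OF m(1) l(1) _ m(2) l(2,3) AB] by simp
  qed
  then have "a' \<subseteq> ?E"
    using subspace_line[OF E a'(1) u(1) a'(2)] A'E subsetD[OF RE[OF mR] u(2)] by blast
  then show False using a' q by blast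
qed

lemma phi_image: "\<phi> ` L = L'"
proof
  show "\<phi> ` L \<subseteq> L'" by (auto simp: phi_in)
  show "L' \<subseteq> \<phi> ` L"
  proof
    fix l assume l: "l \<in> L'"
    have "\<phi> (\<psi> l) \<in> \<phi> ` L" by (rule imageI[OF psi_in[OF l]])
    then show "l \<in> \<phi> ` L" unfolding phi_psi[OF l] .
  qed
qed

lemma star_case:
  assumes A: "A \<in> P" "A' \<in> P'" "\<phi> ` star L A = star L' A'"
  shows "a \<in> L \<Longrightarrow> b \<in> L \<Longrightarrow> adjacent a b \<Longrightarrow> \<exists>X'\<in>P'. \<phi> a \<inter> \<phi> b = {X'}"
    and "well_defined_on_meets P L (\<lambda>a b. meet (\<phi> a) (\<phi> b))"
    and "collineation P L P' L' (map_of_meets L (\<lambda>a b. meet (\<phi> a) (\<phi> b)))"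
proof -
  interpret D: chow P' L' P L \<psi> \<phi> by (rule swap)
  \<comment> \<open>The point map is obtained by choosing, for each star, the vertex of its
    image.\<close>
  have "\<forall>X\<in>P. \<exists>X'. X' \<in> P' \<and> \<phi> ` star L X = star L' X'"
    using star_to_star[OF A] by (simp add: Bex_def)
  then obtain k where k: "\<And>X. X \<in> P \<Longrightarrow> k X \<in> P'" "\<And>X. X \<in> P \<Longrightarrow> \<phi> ` star L X = star L' (k X)"
    unfolding bchoice_iff by auto
  have inc: "k X \<in> \<phi> l \<longleftrightarrow> X \<in> l" if X: "X \<in> P" and l: "l \<in> L" for X l
    using image_star_iff[OF phi_in[OF l], of X] k(2)[OF X] phi_in[OF l]
    unfolding psi_phi[OF l] star_def by simp
  \<comment> \<open>Here \<open>star_to_star\<close> is applied to \<open>\<psi>\<close>: the star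
    of \<open>X'\<close> pulls back to a star, whose vertex is the preimage of
    \<open>X'\<close>.\<close>
  have surj: "\<exists>X\<in>P. k X = X'" if X': "X' \<in> P'" for X'
  proof -
    have "star L A \<subseteq> L" unfolding star_def by auto
    then have "\<psi> ` star L' A' = star L A" using psi_image_phi A(3) by metis
    then obtain X where X: "X \<in> P" "\<psi> ` star L' X' = star L X"
      using D.star_to_star[OF A(2,1) _ X'] by auto
    have "star L' X' \<subseteq> L'" unfolding star_def by auto
    then have "star L' X' = \<phi> ` star L X" using D.psi_image_phi[of "star L' X'"] X(2) by simp
    then have "star L' (k X) = star L' X'" using k(2)[OF X(1)] by simp
    then have "k X = X'" by (rule S'.star_inj[OF k(1)[OF X(1)] X'])
    then show ?thesis using X(1) by auto
  qed
  have int: "\<phi> a \<inter> \<phi> b = {k X}" if ab: "a \<in> L" "b \<in> L" "a \<noteq> b" "X \<in> a" "X \<in> b" for a b X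
  proof (rule S'.adjacent_meet)
    have X: "X \<in> P" by (rule subsetD[OF S.line_subset[OF ab(1)] ab(4)])
    show "k X \<in> \<phi> a" "k X \<in> \<phi> b" using inc[OF X] ab by simp_all
    show "\<phi> a \<noteq> \<phi> b" using phi_inj[OF ab(1,2)] ab(3) by auto
  qed (use ab in \<open>simp_all add: phi_in\<close>)
  have meet: "meet (\<phi> a) (\<phi> b) = k X" if "a \<in> L" "b \<in> L" "a \<noteq> b" "X \<in> a" "X \<in> b" for a b X
    unfolding meet_def int[OF that] by simp
  show "\<exists>X'\<in>P'. \<phi> a \<inter> \<phi> b = {X'}" if ab: "a \<in> L" "b \<in> L" "adjacent a b"
  proof -
    obtain X where X: "X \<in> a" "X \<in> b" using ab(3) unfolding adjacent_def related_def by auto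
    have "\<phi> a \<inter> \<phi> b = {k X}" using int[OF ab(1,2) _ X] ab(3) unfolding adjacent_def by simp
    moreover have "X \<in> P" by (rule subsetD[OF S.line_subset[OF ab(1)] X(1)])
    ultimately show ?thesis using k(1) by auto
  qed
  show "well_defined_on_meets P L (\<lambda>a b. meet (\<phi> a) (\<phi> b))"
    by (rule S.well_defined_meets[OF meet])
  have eq: "map_of_meets L (\<lambda>a b. meet (\<phi> a) (\<phi> b)) X = k X" if "X \<in> P" for X
    by (rule S.map_of_meets_eq[OF meet that])
  show "collineation P L P' L' (map_of_meets L (\<lambda>a b. meet (\<phi> a) (\<phi> b)))"
  proof (rule S.incidence_collineation[where g = \<phi>])
    show "L' = \<phi> ` L" by (rule phi_image[symmetric])
    show "\<And>l. l \<in> L \<Longrightarrow> \<phi> l \<subseteq> P'" by (rule S'.line_subset[OF phi_in])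
    show "\<exists>X\<in>P. map_of_meets L (\<lambda>a b. meet (\<phi> a) (\<phi> b)) X = X'" if "X' \<in> P'" for X'
      using surj[OF that] by (elim bexE) (auto simp: eq)
  qed (simp_all add: eq k(1) inc)
qed

end

section \<open>Stars mapped to planes\<close>

text \<open>By \<open>star_to_star\<close> this assumption holds as soon as a single star is not
  mapped onto a star. It passes to \<open>\<psi>\<close>, so the exchange of the two spaces stays
  available.\<close>

locale dual_chow = chow +
  assumes no_star: "A \<in> P \<Longrightarrow> A' \<in> P' \<Longrightarrow> \<phi> ` star L A \<noteq> star L' A'"
begin

lemma swap_dual: "dual_chow P' L' P L \<psi> \<phi>"
proof -
  interpret D: chow P' L' P L \<psi> \<phi> by (rule swap)
  show ?thesis
  proof unfold_locales
    fix X A assume X: "X \<in> P'" and A: "A \<in> P"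
    show "\<psi> ` star L' X \<noteq> star L A"
    proof
      assume "\<psi> ` star L' X = star L A"
      moreover have "star L' X \<subseteq> L'" unfolding star_def by auto
      ultimately have "\<phi> ` star L A = star L' X" using D.psi_image_phi[of "star L' X"] by simp
      then show False using no_star[OF A X] by simp
    qed
  qed
qed

abbreviation E :: "'a \<Rightarrow> 'b set" where
  "E A \<equiv> ls_span P' L' (\<Union>(\<phi> ` star L A))"

text \<open>This is \<open>E\<close> of the exchanged situation, so through \<open>swap_dual\<close>
  every fact about \<open>E\<close> can be read as one about \<open>F\<close>.\<close>

abbreviation F :: "'b \<Rightarrow> 'a set" where
  "F X \<equiv> ls_span P L (\<Union>(\<psi> ` star L' X))"

lemma star_coplanar: "A \<in> P \<Longrightarrow> coplanar_maximal_related_set P' L' (\<phi> ` star L A)"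
  using maximal_image[OF S.star_maximal[of A]] no_star[of A]
  unfolding coplanar_maximal_related_set_def by auto

lemma E_subspace: "A \<in> P \<Longrightarrow> ls_subspace P' L' (E A)"
  by (rule S'.coplanar_subspace[OF star_coplanar])

lemma line_in_E:
  assumes "l \<in> L'" "A \<in> \<psi> l"
  shows "l \<subseteq> E A"
proof -
  have "l \<in> \<phi> ` star L A" using image_star_iff[OF assms(1)] assms(2) by simp
  then have "l \<subseteq> \<Union>(\<phi> ` star L A)" by (rule Union_upper)
  then show ?thesis using span_superset by (rule subset_trans)
qed

lemma lines_in_E_meet:
  assumes "l \<in> L'" "m \<in> L'" "A \<in> \<psi> l" "A \<in> \<psi> m"
  shows "l \<inter> m \<noteq> {}"
proof -
  have "related (\<psi> l) (\<psi> m)" using assms(3,4) unfolding related_def by auto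
  then show ?thesis
    using rel[OF psi_in[OF assms(1)] psi_in[OF assms(2)]]
    unfolding phi_psi[OF assms(1)] phi_psi[OF assms(2)] by (simp add: related_def)
qed

lemma E_eq_span:
  assumes "A \<in> P" "l \<in> L'" "m \<in> L'" "l \<noteq> m" "A \<in> \<psi> l" "A \<in> \<psi> m"
  shows "E A = ls_span P' L' (l \<union> m)"
proof -
  have "l \<in> \<phi> ` star L A" "m \<in> \<phi> ` star L A"
    using image_star_iff[OF assms(2)] image_star_iff[OF assms(3)] assms(5,6) by simp_all
  then show ?thesis by (rule S'.coplanar_triangle[OF star_coplanar[OF assms(1)] _ _ assms(4)])
qed

lemma two_lines_in_E:
  assumes "A \<in> P"
  obtains l m where "l \<in> L'" "m \<in> L'" "l \<noteq> m" "A \<in> \<psi> l" "A \<in> \<psi> m"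
proof -
  obtain a b where ab: "a \<in> L" "b \<in> L" "a \<noteq> b" "A \<in> a" "A \<in> b"
    using S.two_lines_through[OF assms] by (elim bexE conjE)
  have "\<phi> a \<noteq> \<phi> b" using phi_inj[OF ab(1,2)] ab(3) by auto
  then show thesis using that[of "\<phi> a" "\<phi> b"] ab by (simp add: phi_in psi_phi)
qed

lemma E_triangle:
  assumes "A \<in> P"
  obtains x y z where "x \<in> P'" "y \<in> P'" "z \<in> P'" "noncollinear L' x y z"
    "E A = ls_span P' L' {x, y, z}"
proof -
  obtain l m where lm: "l \<in> L'" "m \<in> L'" "l \<noteq> m" "A \<in> \<psi> l" "A \<in> \<psi> m"
    using two_lines_in_E[OF assms] .
  have "l \<in> \<phi> ` star L A" "m \<in> \<phi> ` star L A"
    using image_star_iff[OF lm(1)] image_star_iff[OF lm(2)] lm(4,5) by simp_all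
  then show thesis
    by (rule S'.coplanar_triangle[OF star_coplanar[OF assms] _ _ lm(3)]) (rule that)
qed

lemma E_plane: "A \<in> P \<Longrightarrow> plane P' L' (E A)"
  by (metis E_triangle S'.plane_span)

lemma point_off_E:
  assumes "A \<in> P"
  shows "\<exists>q\<in>P'. q \<notin> E A"
proof -
  obtain x y z where "x \<in> P'" "y \<in> P'" "z \<in> P'" "noncollinear L' x y z"
    "E A = ls_span P' L' {x, y, z}" using E_triangle[OF assms] .
  then show ?thesis using S'.span_three[of x y z] by simp
qed

text \<open>Two points of \<open>\<psi> x\<close> are joined to \<open>A\<close>. The two lines
  differ because \<open>A\<close> is off \<open>\<psi> x\<close>, and their images meet
  \<open>x\<close> because \<open>\<phi>\<close> preserves relatedness.\<close>

lemma two_lines_related: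
  assumes A: "A \<in> P" and x: "x \<in> L'" "A \<notin> \<psi> x"
  obtains u v where "u \<in> L'" "v \<in> L'" "u \<noteq> v" "A \<in> \<psi> u" "A \<in> \<psi> v" "u \<inter> x \<noteq> {}" "v \<inter> x \<noteq> {}"
proof -
  have xL: "\<psi> x \<in> L" by (rule psi_in[OF x(1)])
  obtain Y Z where YZ: "Y \<in> \<psi> x" "Z \<in> \<psi> x" "Y \<noteq> Z" using S.line_two[OF xL] by (elim bexE)
  have P: "Y \<in> P" "Z \<in> P" using S.line_subset[OF xL] YZ(1,2) by (simp_all add: subsetD)
  have ne: "A \<noteq> Y" "A \<noteq> Z" using x(2) YZ by auto
  obtain u where u: "u \<in> L" "A \<in> u" "Y \<in> u" using S.line_ex[OF A P(1) ne(1)] by (elim bexE conjE)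
  obtain v where v: "v \<in> L" "A \<in> v" "Z \<in> v" using S.line_ex[OF A P(2) ne(2)] by (elim bexE conjE)
  have "u \<noteq> v"
  proof
    assume "u = v"
    then have "u = \<psi> x" using S.line_unique[OF u(1) xL u(3) _ YZ] v(3) by simp
    then show False using u(2) x(2) by simp
  qed
  then have "\<phi> u \<noteq> \<phi> v" using phi_inj[OF u(1) v(1)] by auto
  moreover have "\<phi> u \<inter> x \<noteq> {}" if "u \<in> L" "W \<in> u" "W \<in> \<psi> x" for u W
  proof -
    have "related u (\<psi> x)" using that(2,3) unfolding related_def by auto
    then show ?thesis using rel[OF that(1) xL] phi_psi[OF x(1)] by (simp add: related_def)
  qed
  ultimately show thesis
    using that[of "\<phi> u" "\<phi> v"] u v YZ by (simp add: phi_in psi_phi)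
qed

lemma line_meets_E:
  assumes A: "A \<in> P" and x: "x \<in> L'"
  shows "\<exists>Z\<in>x. Z \<in> E A"
proof (cases "A \<in> \<psi> x")
  case True
  then have "x \<subseteq> E A" by (rule line_in_E[OF x])
  moreover have "x \<noteq> {}" by (rule S'.line_ne[OF x])
  ultimately show ?thesis by auto
next
  case False
  obtain u v where "u \<in> L'" "v \<in> L'" "u \<noteq> v" "A \<in> \<psi> u" "A \<in> \<psi> v" "u \<inter> x \<noteq> {}" "v \<inter> x \<noteq> {}"
    using two_lines_related[OF A x False] .
  then show ?thesis using line_in_E[of u A] by auto
qed

text \<open>A line \<open>x\<close> through \<open>X\<close> that leaves the plane
  \<open>E A\<close> meets it in \<open>X\<close> only. The two image lines that
  \<open>two_lines_related\<close> provides lie in \<open>E A\<close> and meet \<open>x\<close>,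
  hence pass through \<open>X\<close>.\<close>

lemma two_lines_through_in_E:
  assumes A: "A \<in> P" and X: "X \<in> P'" "X \<in> E A"
  obtains u v where "u \<in> L'" "v \<in> L'" "u \<noteq> v" "A \<in> \<psi> u" "A \<in> \<psi> v" "X \<in> u" "X \<in> v"
proof -
  obtain q where q: "q \<in> P'" "q \<notin> E A" using point_off_E[OF A] by (elim bexE)
  then have "X \<noteq> q" using X(2) by auto
  then obtain x where x: "x \<in> L'" "X \<in> x" "q \<in> x" using S'.line_ex[OF X(1) q(1)] by auto
  have only: "W = X" if "W \<in> x" "W \<in> E A" for W
  proof (rule ccontr)
    assume "W \<noteq> X"
    then have "x \<subseteq> E A" by (rule subspace_line[OF E_subspace[OF A] x(1) that(1) x(2) _ that(2) X(2)])
    then show False using q(2) x(3) by auto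
  qed
  have "A \<notin> \<psi> x" using line_in_E[OF x(1), of A] q(2) x(3) by auto
  then obtain u v where uv: "u \<in> L'" "v \<in> L'" "u \<noteq> v" "A \<in> \<psi> u" "A \<in> \<psi> v"
    "u \<inter> x \<noteq> {}" "v \<inter> x \<noteq> {}" using two_lines_related[OF A x(1)] by metis
  have "X \<in> w" if w: "w \<in> L'" "A \<in> \<psi> w" "w \<inter> x \<noteq> {}" for w
  proof -
    obtain W where W: "W \<in> w" "W \<in> x" using w(3) by auto
    have "W = X" by (rule only[OF W(2) subsetD[OF line_in_E[OF w(1,2)] W(1)]])
    then show ?thesis using W(1) by simp
  qed
  then show thesis using that[OF uv(1-5)] uv by simp
qed

text \<open>A line \<open>u\<close> through \<open>X\<close> with \<open>A\<close> on
  \<open>\<psi> u\<close> exhibits \<open>A\<close> on the preimage of a line of the star of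
  \<open>X\<close>. Applied to \<open>\<psi>\<close>, the lemma gives the converse.\<close>

lemma E_imp_F:
  assumes A: "A \<in> P" and X: "X \<in> P'" "X \<in> E A"
  shows "A \<in> F X"
proof -
  interpret D: dual_chow P' L' P L \<psi> \<phi> by (rule swap_dual)
  obtain u v where u: "u \<in> L'" "v \<in> L'" "u \<noteq> v" "A \<in> \<psi> u" "A \<in> \<psi> v" "X \<in> u" "X \<in> v"
    using two_lines_through_in_E[OF assms] .
  have "\<psi> u \<subseteq> F X" using D.line_in_E[of "\<psi> u" X] u(1,6) by (simp add: psi_in phi_psi)
  then show ?thesis using u(4) by (rule subsetD)
qed

text \<open>If \<open>\<psi> l\<close> avoids \<open>A\<close>, then \<open>F X\<close> is the same plane \<open>G\<close> for all \<open>X \<in> l\<close>, and \<open>E B\<close> misses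
  \<open>l\<close> for all \<open>B \<notin> G\<close>.\<close>

lemma lines_of_E:
  assumes A: "A \<in> P" and l: "l \<in> L'" "l \<subseteq> E A"
  shows "A \<in> \<psi> l"
proof (rule ccontr)
  assume notin: "A \<notin> \<psi> l"
  interpret D: dual_chow P' L' P L \<psi> \<phi> by (rule swap_dual)
  let ?S = "insert A (\<psi> l)"
  have lL: "\<psi> l \<in> L" by (rule psi_in[OF l(1)])
  have SP: "?S \<subseteq> P" using A S.line_subset[OF lL] by simp
  \<comment> \<open>As \<open>A\<close> is in \<open>F X\<close>, some line \<open>u\<close> through
    \<open>A\<close> has its image through \<open>X\<close>. Then \<open>F X\<close> is spanned by
    \<open>u\<close> and \<open>\<psi> l\<close>; these meet in a point other than \<open>A\<close>,
    so \<open>u\<close> lies in the span of \<open>A\<close> and \<open>\<psi> l\<close>, which does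
    not depend on \<open>X\<close>.\<close>
  have F: "F X = ls_span P L ?S" if "X \<in> l" for X
  proof -
    have X: "X \<in> P'" by (rule subsetD[OF S'.line_subset[OF l(1)] that])
    have "A \<in> F X" using E_imp_F[OF A X] subsetD[OF l(2) that] by simp
    then obtain u v where u: "u \<in> L" "v \<in> L" "u \<noteq> v" "X \<in> \<phi> u" "X \<in> \<phi> v" "A \<in> u" "A \<in> v"
      using D.two_lines_through_in_E[OF X A] by metis
    have Xl: "X \<in> \<phi> (\<psi> l)" using that phi_psi[OF l(1)] by simp
    have ne: "u \<noteq> \<psi> l" using notin u(6) by auto
    have eq: "F X = ls_span P L (u \<union> \<psi> l)" by (rule D.E_eq_span[OF X u(1) lL ne u(4) Xl])
    obtain U where U: "U \<in> u" "U \<in> \<psi> l" using D.lines_in_E_meet[OF u(1) lL u(4) Xl] by auto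
    have "A \<noteq> U" using notin U(2) by auto
    then have "u \<subseteq> ls_span P L ?S" using S.line_in_span[OF u(1,6) U(1) _ _ _ SP] U(2) by simp
    moreover have "\<psi> l \<subseteq> ls_span P L ?S" using span_superset[of ?S P L] by simp
    ultimately have "u \<union> \<psi> l \<subseteq> ls_span P L ?S" by simp
    then have "ls_span P L (u \<union> \<psi> l) \<subseteq> ls_span P L ?S"
      by (rule span_least[OF S.subspace_span[OF SP]])
    moreover have "ls_span P L ?S \<subseteq> ls_span P L (u \<union> \<psi> l)" using u(6) by (intro span_mono) simp
    ultimately show ?thesis unfolding eq by simp
  qed
  obtain X where X: "X \<in> l" using S'.line_ne[OF l(1)] by auto
  have XP: "X \<in> P'" by (rule subsetD[OF S'.line_subset[OF l(1)] X])
  \<comment> \<open>For \<open>B\<close> outside the common plane, \<open>line_meets_E\<close> still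
    yields a point \<open>Z\<close> of \<open>l\<close> in \<open>E B\<close>, and
    \<open>E_imp_F\<close> then puts \<open>B\<close> into \<open>F Z\<close>, which is that
    plane.\<close>
  obtain B where B: "B \<in> P" "B \<notin> F X" using D.point_off_E[OF XP] by (elim bexE)
  obtain Z where Z: "Z \<in> l" "Z \<in> E B" using line_meets_E[OF B(1) l(1)] by (elim bexE)
  have ZP: "Z \<in> P'" by (rule subsetD[OF S'.line_subset[OF l(1)] Z(1)])
  have "B \<in> F Z" by (rule E_imp_F[OF B(1) ZP Z(2)])
  then show False using B(2) F[OF X] F[OF Z(1)] by simp
qed

section \<open>The planes of the image space, its dimension and the correlation\<close>

lemma E_contains_iff:
  assumes "A \<in> P" "l \<in> L'"
  shows "l \<subseteq> E A \<longleftrightarrow> A \<in> \<psi> l"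
  using lines_of_E[OF assms] line_in_E[OF assms(2), of A] by auto

text \<open>Two sides of a triangle spanning the plane meet, hence so do their preimages. The common
  point \<open>A\<close> of the preimages is the witness, since two image lines of its star
  determine \<open>E A\<close>.\<close>

lemma plane_is_E:
  assumes "plane P' L' G"
  shows "\<exists>A\<in>P. E A = G"
proof -
  obtain x y z where xyz: "x \<in> P'" "y \<in> P'" "z \<in> P'" "noncollinear L' x y z"
    "G = ls_span P' L' {x, y, z}" using S'.plane_obtain[OF assms] .
  have xy: "x \<noteq> y" using xyz(4) unfolding noncollinear_def by simp
  obtain l where l: "l \<in> L'" "x \<in> l" "y \<in> l" using S'.line_ex[OF xyz(1,2) xy] by (elim bexE conjE)
  then have "z \<notin> l" using xyz(4) unfolding noncollinear_def by auto
  then have xz: "x \<noteq> z" using l(2) by auto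
  obtain m where m: "m \<in> L'" "x \<in> m" "z \<in> m" using S'.line_ex[OF xyz(1,3) xz] by (elim bexE conjE)
  have lm: "l \<noteq> m" using \<open>z \<notin> l\<close> m(3) by auto
  have "related (\<phi> (\<psi> l)) (\<phi> (\<psi> m))"
    unfolding phi_psi[OF l(1)] phi_psi[OF m(1)] related_def using l(2) m(2) by auto
  then have "related (\<psi> l) (\<psi> m)" by (simp add: rel psi_in l(1) m(1))
  then obtain A where A: "A \<in> \<psi> l" "A \<in> \<psi> m" unfolding related_def by auto
  have AP: "A \<in> P" by (rule subsetD[OF S.line_subset[OF psi_in[OF l(1)]] A(1)])
  have sub: "{x, y, z} \<subseteq> P'" using xyz(1-3) by simp
  have "l \<subseteq> G" "m \<subseteq> G"
    unfolding xyz(5) using S'.line_in_span[OF l xy _ _ sub] S'.line_in_span[OF m xz _ _ sub] by simp_all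
  then have "ls_span P' L' (l \<union> m) \<subseteq> G"
    unfolding xyz(5) by (intro span_least[OF S'.subspace_span[OF sub]]) simp
  moreover have "G \<subseteq> ls_span P' L' (l \<union> m)"
    unfolding xyz(5) using l m by (intro span_mono) simp
  ultimately have "E A = G" unfolding E_eq_span[OF AP l(1) m(1) lm A] by simp
  then show ?thesis using AP by auto
qed

text \<open>Every plane is some \<open>E A\<close>, and all of its lines are images of lines through
  \<open>A\<close>, which are mutually related.\<close>

lemma projective: "generalized_projective_space P' L'"
  unfolding generalized_projective_space_def
proof (intro conjI allI impI)
  show "linear_space P' L'" by (rule S'.lin)
next
  fix G assume G: "plane P' L' G"
  obtain A where A: "A \<in> P" "E A = G" using plane_is_E[OF G] by (elim bexE)
  have "l \<inter> m \<noteq> {}" if "l \<in> lines_in L' G" "m \<in> lines_in L' G" for l m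
  proof (rule lines_in_E_meet)
    show "l \<in> L'" "m \<in> L'" using that unfolding lines_in_def by simp_all
    then show "A \<in> \<psi> l" "A \<in> \<psi> m"
      using that lines_of_E[OF A(1)] A(2) unfolding lines_in_def by simp_all
  qed
  then show "generalized_projective_plane G (lines_in L' G)"
    using G S'.linear_subspace unfolding generalized_projective_plane_def plane_def by simp
qed

text \<open>A triangle spanning \<open>E A\<close> together with a point \<open>q\<close> off this
  plane spans everything, because the line joining \<open>q\<close> to any other point meets
  \<open>E A\<close>. Four points give dimension at most 3.\<close>

lemma dim_eq_3:
  assumes A: "A \<in> P"
  shows "ls_dim P' L' = 3"
proof -
  obtain x y z where xyz: "x \<in> P'" "y \<in> P'" "z \<in> P'" "noncollinear L' x y z"
    "E A = ls_span P' L' {x, y, z}" using E_triangle[OF A] .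
  obtain q where q: "q \<in> P'" "q \<notin> E A" using point_off_E[OF A] by (elim bexE)
  let ?S = "{q, x, y, z}"
  have S: "?S \<subseteq> P'" using q(1) xyz by simp
  have T: "ls_subspace P' L' (ls_span P' L' ?S)" by (rule S'.subspace_span[OF S])
  have ES: "E A \<subseteq> ls_span P' L' ?S" unfolding xyz(5) by (rule span_mono) auto
  have qS: "q \<in> ls_span P' L' ?S" by (rule subsetD[OF span_superset]) simp
  have "p \<in> ls_span P' L' ?S" if p: "p \<in> P'" for p
  proof (cases "p = q")
    case True
    then show ?thesis using qS by simp
  next
    case False
    then obtain l where l: "l \<in> L'" "p \<in> l" "q \<in> l" using S'.line_ex[OF p q(1)] by auto
    obtain Z where Z: "Z \<in> l" "Z \<in> E A" using line_meets_E[OF A l(1)] by (elim bexE)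
    have "Z \<noteq> q" using Z(2) q(2) by auto
    then have "l \<subseteq> ls_span P' L' ?S"
      by (rule subspace_line[OF T l(1) Z(1) l(3) _ subsetD[OF ES Z(2)] qS])
    then show ?thesis using l(2) by (rule subsetD)
  qed
  then have "ls_span P' L' ?S = P'" using S'.span_subset[OF S] by auto
  moreover have "card ?S \<le> Suc 3" by (simp add: card_insert_if)
  ultimately have "ls_dim P' L' \<le> ereal (real 3)" by (intro dim_le[OF S]) simp_all
  then show ?thesis using S'.dim3 by (simp add: order_antisym)
qed

lemma join_eq_E:
  assumes "a \<in> L" "b \<in> L" "a \<noteq> b" "X \<in> a" "X \<in> b"
  shows "ls_join P' L' (\<phi> a) (\<phi> b) = E X"
proof -
  have X: "X \<in> P" by (rule subsetD[OF S.line_subset[OF assms(1)] assms(4)])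
  have "\<phi> a \<noteq> \<phi> b" using phi_inj[OF assms(1,2)] assms(3) by auto
  then show ?thesis
    using E_eq_span[OF X, of "\<phi> a" "\<phi> b"] assms unfolding ls_join_def by (simp add: phi_in psi_phi)
qed

lemma correlation_meets:
  "well_defined_on_meets P L (\<lambda>a b. ls_join P' L' (\<phi> a) (\<phi> b))"
  "collineation P L (dual_points P' L') (dual_lines P' L')
    (map_of_meets L (\<lambda>a b. ls_join P' L' (\<phi> a) (\<phi> b)))"
proof -
  show "well_defined_on_meets P L (\<lambda>a b. ls_join P' L' (\<phi> a) (\<phi> b))"
    by (rule S.well_defined_meets[OF join_eq_E])
  have eq: "map_of_meets L (\<lambda>a b. ls_join P' L' (\<phi> a) (\<phi> b)) X = E X" if "X \<in> P" for X
    by (rule S.map_of_meets_eq[OF join_eq_E that])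
  show "collineation P L (dual_points P' L') (dual_lines P' L')
    (map_of_meets L (\<lambda>a b. ls_join P' L' (\<phi> a) (\<phi> b)))"
  \<comment> \<open>The dual line belonging to \<open>l\<close> is the pencil of planes on
    \<open>\<phi> l\<close>; the required incidence is \<open>E_contains_iff\<close>.\<close>
  proof (rule S.incidence_collineation[where g = "\<lambda>a. pencil P' L' (\<phi> a)"])
    show "dual_lines P' L' = (\<lambda>a. pencil P' L' (\<phi> a)) ` L"
      unfolding dual_lines_def phi_image[symmetric] image_image by simp
    show "pencil P' L' (\<phi> l) \<subseteq> dual_points P' L'" for l
      unfolding pencil_def dual_points_def by auto
    show "\<exists>X\<in>P. map_of_meets L (\<lambda>a b. ls_join P' L' (\<phi> a) (\<phi> b)) X = G"
      if "G \<in> dual_points P' L'" for G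
    proof -
      have "plane P' L' G" using \<open>G \<in> dual_points P' L'\<close> unfolding dual_points_def by simp
      then have "\<exists>A\<in>P. E A = G" by (rule plane_is_E)
      then obtain A where "A \<in> P" "E A = G" by (elim bexE)
      then show ?thesis using eq[of A] by auto
    qed
  next
    fix X assume X: "X \<in> P"
    show "map_of_meets L (\<lambda>a b. ls_join P' L' (\<phi> a) (\<phi> b)) X \<in> dual_points P' L'"
      using E_plane[OF X] unfolding dual_points_def eq[OF X] by simp
    fix l assume l: "l \<in> L"
    show "map_of_meets L (\<lambda>a b. ls_join P' L' (\<phi> a) (\<phi> b)) X \<in> pencil P' L' (\<phi> l) \<longleftrightarrow> X \<in> l"
      using E_plane[OF X] E_contains_iff[OF X phi_in[OF l]]
      unfolding pencil_def eq[OF X] psi_phi[OF l] by simp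
  qed
qed

end

section \<open>The three assertions for the given bijection and its inverse\<close>

theorem theorem1:
  fixes P :: "'a set" and L :: "'a set set"
    and P' :: "'b set" and L' :: "'b set set"
    and \<phi> :: "'a set \<Rightarrow> 'b set"
  assumes "linear_space P L" and "linear_space P' L'"
    and "ls_dim P L \<ge> 3" and "ls_dim P' L' \<ge> 3"
    and "bij_betw \<phi> L L'"
    and "\<forall>a\<in>L. \<forall>b\<in>L. related a b \<longleftrightarrow> related (\<phi> a) (\<phi> b)"
  defines "\<kappa> \<equiv> map_of_meets L (\<lambda>a b. meet (\<phi> a) (\<phi> b))"
    and "\<delta> \<equiv> map_of_meets L (\<lambda>a b. ls_join P' L' (\<phi> a) (\<phi> b))"
  shows
    "((\<forall>R. maximal_related_set L R \<longrightarrow> maximal_related_set L' (\<phi> ` R)) \<and>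
      (\<forall>R'. maximal_related_set L' R' \<longrightarrow> maximal_related_set L (inv_into L \<phi> ` R')))
     \<and>
     ((\<exists>A\<in>P. \<exists>A'\<in>P'. \<phi> ` star L A = star L' A') \<longrightarrow>
        (\<forall>a\<in>L. \<forall>b\<in>L. adjacent a b \<longrightarrow> (\<exists>X'\<in>P'. \<phi> a \<inter> \<phi> b = {X'})) \<and>
        well_defined_on_meets P L (\<lambda>a b. meet (\<phi> a) (\<phi> b)) \<and>
        collineation P L P' L' \<kappa>)
     \<and>
     ((\<exists>A\<in>P. coplanar_maximal_related_set P' L' (\<phi> ` star L A)) \<longrightarrow>
        generalized_projective_space P' L' \<and> ls_dim P' L' = 3 \<and>
        well_defined_on_meets P L (\<lambda>a b. ls_join P' L' (\<phi> a) (\<phi> b)) \<and>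
        collineation P L (dual_points P' L') (dual_lines P' L') \<delta> \<and>
        generalized_projective_space P L \<and> ls_dim P L = 3 \<and>
        correlation P L P' L' \<delta>)"
proof -
  let ?\<psi> = "inv_into L \<phi>"
  have inj: "inj_on \<phi> L" and im: "\<phi> ` L = L'" using assms(5) unfolding bij_betw_def by auto
  interpret C: chow P L P' L' \<phi> ?\<psi>
  proof unfold_locales
    show "\<phi> a \<in> L'" if "a \<in> L" for a using imageI[OF that, of \<phi>] im by simp
    show "?\<psi> a' \<in> L" if "a' \<in> L'" for a' using inv_into_into[of a' \<phi> L] that im by simp
    show "?\<psi> (\<phi> a) = a" if "a \<in> L" for a by (rule inv_into_f_f[OF inj that])
    show "\<phi> (?\<psi> a') = a'" if "a' \<in> L'" for a' using f_inv_into_f[of a' \<phi> L] that im by simp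
    show "related (\<phi> a) (\<phi> b) \<longleftrightarrow> related a b" if "a \<in> L" "b \<in> L" for a b
      using assms(6) that by simp
  qed (rule assms)+
  interpret C': chow P' L' P L ?\<psi> \<phi> by (rule C.swap)
  have 1: "(\<forall>R. maximal_related_set L R \<longrightarrow> maximal_related_set L' (\<phi> ` R)) \<and>
      (\<forall>R'. maximal_related_set L' R' \<longrightarrow> maximal_related_set L (?\<psi> ` R'))"
    using C.maximal_image C'.maximal_image by simp
  have 2: "(\<forall>a\<in>L. \<forall>b\<in>L. adjacent a b \<longrightarrow> (\<exists>X'\<in>P'. \<phi> a \<inter> \<phi> b = {X'})) \<and>
        well_defined_on_meets P L (\<lambda>a b. meet (\<phi> a) (\<phi> b)) \<and>
        collineation P L P' L' \<kappa>"
    if ex: "\<exists>A\<in>P. \<exists>A'\<in>P'. \<phi> ` star L A = star L' A'"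
  proof -
    obtain A A' where A: "A \<in> P" "A' \<in> P'" "\<phi> ` star L A = star L' A'" using ex by (elim bexE)
    show ?thesis unfolding \<kappa>_def using C.star_case[OF A] by simp
  qed
  have 3: "generalized_projective_space P' L' \<and> ls_dim P' L' = 3 \<and>
        well_defined_on_meets P L (\<lambda>a b. ls_join P' L' (\<phi> a) (\<phi> b)) \<and>
        collineation P L (dual_points P' L') (dual_lines P' L') \<delta> \<and>
        generalized_projective_space P L \<and> ls_dim P L = 3 \<and>
        correlation P L P' L' \<delta>"
    if ex: "\<exists>A\<in>P. coplanar_maximal_related_set P' L' (\<phi> ` star L A)"
  proof -
    obtain A where A: "A \<in> P" "coplanar_maximal_related_set P' L' (\<phi> ` star L A)"
      using ex by (elim bexE)
    \<comment> \<open>If any star were mapped onto a star, so would be the star of \<open>A\<close>,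
      contrary to its coplanar image.\<close>
    interpret K: dual_chow P L P' L' \<phi> ?\<psi>
    proof unfold_locales
      fix B B' assume B: "B \<in> P" "B' \<in> P'"
      show "\<phi> ` star L B \<noteq> star L' B'"
      proof
        assume "\<phi> ` star L B = star L' B'"
        then have "\<exists>A'\<in>P'. \<phi> ` star L A = star L' A'" by (rule C.star_to_star[OF B _ A(1)])
        then show False using A(2) unfolding coplanar_maximal_related_set_def by simp
      qed
    qed
    interpret K': dual_chow P' L' P L ?\<psi> \<phi> by (rule K.swap_dual)
    \<comment> \<open>The dimension of \<open>(P, L)\<close> comes from the exchanged situation,
      where the base point has to be taken in \<open>P'\<close>.\<close>
    obtain q where q: "q \<in> P'" using K.point_off_E[OF A(1)] by (elim bexE)
    have dims: "ls_dim P L = 3" "ls_dim P' L' = 3"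
      by (rule K'.dim_eq_3[OF q], rule K.dim_eq_3[OF A(1)])
    show ?thesis
      unfolding correlation_def \<delta>_def
      using dims K.projective K'.projective K.correlation_meets by simp
  qed
  show ?thesis using 1 2 3 by simp
qed

end
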